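(* Let $I\subset\mathcal U$ be a two-sided ideal containing $I_{\mathrm C}$. Then the elements $h_1(\mathbf u),h_2(\mathbf u),\dots$ commute pairwise modulo $I$. Consequently $H(x)H(y)\equiv H(y)H(x)\bmod I[[x,y]]$, where $H(x)=\sum_{\ell\ge0}x^\ell h_\ell(\mathbf u)$ and $x,y$ are formal variables commuting with each other and with $u_1,\dots,u_N$.
   Context: $\mathcal U=\mathbb Z\langle u_1,\dots,u_N\rangle$ is the free associative ring. $h_\ell(\mathbf u)=\sum_{1\le i_1\le\cdots\le i_\ell\le N}u_{i_1}\cdots u_{i_\ell}$ for $\ell>0$, $h_0=1$. $I_{\mathrm C}$ is the two-sided ideal generated by $u_b^2u_a+u_au_bu_a-u_bu_au_b-u_bu_a^2$ ($a<b$), $u_bu_cu_a+u_au_cu_b-u_bu_au_c-u_cu_au_b$ ($a<b<c$), $u_cu_bu_cu_a+u_bu_cu_au_c-u_cu_bu_au_c-u_bu_c^2u_a$ ($a<b<c$). *)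

theory Defs
  imports Main "HOL-Library.Poly_Mapping" "HOL-Computational_Algebra.Formal_Power_Series"
begin

datatype 'n fword = Word "'n list"

instantiation fword :: (type) monoid_add
begin
definition zero_fword :: "'n fword" where "zero_fword = Word []"
fun plus_fword :: "'n fword \<Rightarrow> 'n fword \<Rightarrow> 'n fword" where
  "plus_fword (Word xs) (Word ys) = Word (xs @ ys)"
instance
proof
  fix a b c :: "'n fword"
  show "a + b + c = a + (b + c)" by (cases a; cases b; cases c) simp
  show "0 + a = a" by (cases a) (simp add: zero_fword_def)
  show "a + 0 = a" by (cases a) (simp add: zero_fword_def)
qed
end

text \<open>The free associative ring Z<u_i : i in 'n>: finitely supported integer
  combinations of words, with convolution product. The index type 'n is finite
  and linearly ordered (N = CARD('n)).\<close>
type_synonym 'n freering = "'n fword \<Rightarrow>\<^sub>0 int"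

definition u :: "'n \<Rightarrow> 'n freering" where
  "u i = Poly_Mapping.single (Word [i]) 1"

definition hsym :: "nat \<Rightarrow> ('n::{finite,linorder}) freering" where
  "hsym l = (\<Sum>xs\<in>{xs :: 'n list. length xs = l \<and> sorted xs}. prod_list (map u xs))"

definition two_sided_ideal :: "('a::ring_1) set \<Rightarrow> bool" where
  "two_sided_ideal I \<longleftrightarrow> 0 \<in> I \<and> (\<forall>x\<in>I. \<forall>y\<in>I. x + y \<in> I) \<and> (\<forall>x\<in>I. - x \<in> I)
     \<and> (\<forall>x\<in>I. \<forall>a b. a * x * b \<in> I)"

definition gensC :: "('n::linorder) freering set" where
  "gensC =
     {u b * u b * u a + u a * u b * u a - u b * u a * u b - u b * u a * u a | a b. a < b}
   \<union> {u b * u c * u a + u a * u c * u b - u b * u a * u c - u c * u a * u b | a b c. a < b \<and> b < c}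
   \<union> {u c * u b * u c * u a + u b * u c * u a * u c - u c * u b * u a * u c - u b * u c * u c * u a
       | a b c. a < b \<and> b < c}"

definition I_C :: "('n::linorder) freering set" where
  "I_C = \<Inter>{J. two_sided_ideal J \<and> gensC \<subseteq> J}"

text \<open>H(x) and H(y) as bivariate power series in x (outer) and y (inner) over the free ring.\<close>
definition Hx :: "('n::{finite,linorder}) freering fps fps" where
  "Hx = Abs_fps (\<lambda>l. fps_const (hsym l))"

definition Hy :: "('n::{finite,linorder}) freering fps fps" where
  "Hy = fps_const (Abs_fps hsym)"

end

theory Submission
  imports Defs
begin

text \<open>Write \<open>w\<^sub>i\<close> for the image of \<open>u\<^sub>i\<close> in \<open>U/I_C\<close> and
  \<open>E(t) = (1 + t w\<^sub>N) \<cdots> (1 + t w\<^sub>1)\<close> for central \<open>t\<close>. The three families of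
  relations are what makes it possible to move the largest letter \<open>w\<^sub>m\<close> from the right
  of a product over smaller letters to its left, at the cost of a sum of commutators
  that does not depend on \<open>t\<close>. Induction on the alphabet then gives
  \<open>E(x) E(y) = E(y) E(x)\<close>. Over power series
  \<open>H(x) = (1 - x w\<^sub>1)\<^sup>-\<^sup>1 \<cdots> (1 - x w\<^sub>N)\<^sup>-\<^sup>1\<close> is the inverse of
  \<open>E(-x)\<close> and has the \<open>h\<^sub>l\<close> as coefficients, and inverses of commuting units
  commute; comparing coefficients of \<open>H(x) H(y) = H(y) H(x)\<close> gives the claim.\<close>

context
  fixes J :: "'a::ring_1 set"
  assumes J: "two_sided_ideal J"
begin

lemma two_sided_ideal_zero: "0 \<in> J"
  using J unfolding two_sided_ideal_def by blast

lemma two_sided_ideal_add: "x \<in> J \<Longrightarrow> y \<in> J \<Longrightarrow> x + y \<in> J"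
  using J unfolding two_sided_ideal_def by blast

lemma two_sided_ideal_uminus: "x \<in> J \<Longrightarrow> - x \<in> J"
  using J unfolding two_sided_ideal_def by blast

lemma two_sided_ideal_diff: "x \<in> J \<Longrightarrow> y \<in> J \<Longrightarrow> x - y \<in> J"
  by (metis diff_conv_add_uminus two_sided_ideal_add two_sided_ideal_uminus)

lemma two_sided_ideal_mult_left: "x \<in> J \<Longrightarrow> a * x \<in> J"
  using J unfolding two_sided_ideal_def by (metis mult_1_right)

lemma two_sided_ideal_mult_right: "x \<in> J \<Longrightarrow> x * b \<in> J"
  using J unfolding two_sided_ideal_def by (metis mult_1_left)

lemma two_sided_ideal_cong_add: "a - a' \<in> J \<Longrightarrow> b - b' \<in> J \<Longrightarrow> (a + b) - (a' + b') \<in> J"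
  using two_sided_ideal_add[of "a - a'" "b - b'"] by (simp add: algebra_simps)

lemma two_sided_ideal_cong_uminus: "a - a' \<in> J \<Longrightarrow> - a - - a' \<in> J"
  using two_sided_ideal_uminus[of "a - a'"] by (simp add: algebra_simps)

lemma two_sided_ideal_cong_diff: "a - a' \<in> J \<Longrightarrow> b - b' \<in> J \<Longrightarrow> (a - b) - (a' - b') \<in> J"
  using two_sided_ideal_diff[of "a - a'" "b - b'"] by (simp add: algebra_simps)

lemma two_sided_ideal_cong_mult: "a - a' \<in> J \<Longrightarrow> b - b' \<in> J \<Longrightarrow> a * b - a' * b' \<in> J"
proof -
  assume "a - a' \<in> J" "b - b' \<in> J"
  then have "(a - a') * b + a' * (b - b') \<in> J"
    by (intro two_sided_ideal_add two_sided_ideal_mult_left two_sided_ideal_mult_right)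
  then show ?thesis
    by (simp add: algebra_simps)
qed

lemma equivp_two_sided_ideal_cong: "equivp (\<lambda>a b. a - b \<in> J)"
proof (rule equivpI)
  show "reflp (\<lambda>a b. a - b \<in> J)"
    by (rule reflpI) (simp add: two_sided_ideal_zero)
  show "symp (\<lambda>a b. a - b \<in> J)"
    by (rule sympI) (metis minus_diff_eq two_sided_ideal_uminus)
  show "transp (\<lambda>a b. a - b \<in> J)"
    by (rule transpI) (drule (1) two_sided_ideal_add, simp)
qed

end

lemma two_sided_ideal_Inter:
  "(\<And>J. J \<in> F \<Longrightarrow> two_sided_ideal J) \<Longrightarrow> two_sided_ideal (\<Inter>F)"
  unfolding two_sided_ideal_def by blast

section \<open>Commuting noncommutative elementary products\<close>

definition commutator :: "'a::ring \<Rightarrow> 'a \<Rightarrow> 'a" where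
  "commutator x y = x * y - y * x"

definition central :: "'a::times \<Rightarrow> bool" where
  "central t \<longleftrightarrow> (\<forall>z. t * z = z * t)"

lemma central_left_commute:
  fixes t :: "'a::semigroup_mult"
  assumes "central t"
  shows "z * (t * q) = t * (z * q)"
proof -
  have "z * (t * q) = (z * t) * q"
    by (simp add: mult.assoc)
  also have "\<dots> = t * (z * q)"
    using assms by (simp add: central_def mult.assoc)
  finally show ?thesis .
qed

text \<open>For increasing \<open>L = [a\<^sub>1, \<dots>, a\<^sub>k]\<close> this is
  \<open>(1 + t w\<^sub>a\<^sub>k) \<cdots> (1 + t w\<^sub>a\<^sub>1)\<close>, the noncommutative elementary
  generating function \<open>E(t)\<close>.\<close>

fun eprod :: "('n \<Rightarrow> 'a::ring_1) \<Rightarrow> 'a \<Rightarrow> 'n list \<Rightarrow> 'a" where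
  "eprod w t [] = 1"
| "eprod w t (a # L) = eprod w t L * (1 + t * w a)"

lemma eprod_snoc: "eprod w t (L @ [m]) = (1 + t * w m) * eprod w t L"
  by (induction L) (simp_all add: mult.assoc)

lemma eprod_hom:
  assumes "\<And>a b. F (a * b) = F a * F b" "\<And>a b. F (a + b) = F a + F b" "F 1 = 1"
  shows "F (eprod w t L) = eprod (\<lambda>a. F (w a)) (F t) L"
  by (induction L) (simp_all add: assms)

lemma eprod_commute:
  assumes "\<And>b. b \<in> set L \<Longrightarrow> z * w b = w b * z" and t: "central t"
  shows "eprod w t L * z = z * eprod w t L"
  using assms(1)
proof (induction L)
  case Nil
  then show ?case by simp
next
  case (Cons a L)
  have "(1 + t * w a) * z = z + t * (w a * z)"
    by (simp add: algebra_simps)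
  also have "\<dots> = z * (1 + t * w a)"
    using Cons.prems central_left_commute[OF t] by (simp add: algebra_simps)
  finally have step: "(1 + t * w a) * z = z * (1 + t * w a)" .
  have "eprod w t (a # L) * z = eprod w t L * ((1 + t * w a) * z)"
    by (simp add: mult.assoc)
  also have "\<dots> = (eprod w t L * z) * (1 + t * w a)"
    by (simp add: step mult.assoc)
  also have "\<dots> = z * eprod w t (a # L)"
    using Cons by (simp add: mult.assoc)
  finally show ?case .
qed

locale C_relations =
  fixes w :: "'n::linorder \<Rightarrow> 'a::ring_1"
  assumes rel_two_letters:
      "a < b \<Longrightarrow> w b * commutator (w b) (w a) = commutator (w b) (w a) * w a"
    and rel_three_letters:
      "a < b \<Longrightarrow> b < c \<Longrightarrow> w b * commutator (w c) (w a) = commutator (w c) (w a) * w b"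
    and rel_commutators:
      "a < b \<Longrightarrow> b < c \<Longrightarrow> commutator (w c) (w b) * commutator (w c) (w a) = 0"

lemma C_relations_hom:
  assumes "C_relations w"
    and "\<And>a b. F (a * b) = F a * F b" "\<And>a b. F (a - b) = F a - F b" "F 0 = 0"
  shows "C_relations (\<lambda>i. F (w i))"
proof -
  have "commutator (F (w i)) (F (w j)) = F (commutator (w i) (w j))" for i j
    by (simp add: commutator_def assms(2,3))
  then show ?thesis
    using assms(1) unfolding C_relations_def by (simp flip: assms(2,4))
qed

context C_relations
begin

lemma eprod_commute_commutator:
  assumes t: "central t" and L: "\<forall>b\<in>set L. a < b \<and> b < m"
  shows "eprod w t L * commutator (w m) (w a) = commutator (w m) (w a) * eprod w t L"
proof (rule eprod_commute[OF _ t])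
  fix b
  assume "b \<in> set L"
  with L have "a < b" "b < m" by auto
  then show "commutator (w m) (w a) * w b = w b * commutator (w m) (w a)"
    by (simp add: rel_three_letters)
qed

lemma letter_eprod_commutator:
  assumes t: "central t" and L: "\<forall>b\<in>set L. a < b \<and> b < m"
  shows "w m * eprod w t L * commutator (w m) (w a) = eprod w t L * w m * commutator (w m) (w a)"
  using L
proof (induction L)
  case Nil
  then show ?case by simp
next
  case (Cons b L)
  let ?c = "commutator (w m) (w a)" and ?E = "eprod w t L" and ?f = "1 + t * w b"
  from Cons.prems have ab: "a < b" "b < m" by auto
  have IH: "w m * ?E * ?c = ?E * w m * ?c"
    using Cons by simp
  have f_c: "?f * ?c = ?c * ?f"
    using rel_three_letters[OF ab] central_left_commute[OF t] by (simp add: algebra_simps)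
  have m_f: "w m * ?f = ?f * w m + t * commutator (w m) (w b)"
    using central_left_commute[OF t] by (simp add: algebra_simps commutator_def)
  have "w m * (?E * ?f) * ?c = w m * ?E * ?c * ?f"
    by (simp add: mult.assoc f_c)
  also have "\<dots> = ?E * w m * ?c * ?f"
    by (simp only: IH)
  also have "\<dots> = ?E * (w m * ?f) * ?c"
    by (simp add: mult.assoc f_c)
  also have "\<dots> = ?E * ?f * w m * ?c + ?E * t * (commutator (w m) (w b) * ?c)"
    by (simp only: m_f) (simp add: algebra_simps)
  also have "\<dots> = ?E * ?f * w m * ?c"
    by (simp add: rel_commutators[OF ab])
  finally show ?case
    by simp
qed

lemma commutator_eprod_shift:
  assumes t: "central t" and am: "a < m" and L: "\<forall>b\<in>set L. a < b \<and> b < m"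
  shows "(1 + t * w m) * eprod w t L * commutator (w m) (w a)
    = commutator (w m) (w a) * eprod w t L * (1 + t * w a)"
proof -
  let ?u = "w m" and ?c = "commutator (w m) (w a)" and ?E = "eprod w t L"
  have c_f: "?c * (1 + t * w a) = ?c + t * (?u * ?c)"
    using rel_two_letters[OF am] central_left_commute[OF t] by (simp add: algebra_simps)
  have "?c * ?E * (1 + t * w a) = ?E * (?c * (1 + t * w a))"
    by (simp add: eprod_commute_commutator[OF t L] flip: mult.assoc)
  also have "\<dots> = ?E * (?c + t * (?u * ?c))"
    by (simp only: c_f)
  also have "\<dots> = ?E * ?c + t * (?E * (?u * ?c))"
    by (simp only: distrib_left central_left_commute[OF t])
  also have "\<dots> = ?E * ?c + t * (?u * ?E * ?c)"
    using letter_eprod_commutator[OF t L] by (simp add: mult.assoc)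
  finally show ?thesis
    by (simp add: algebra_simps)
qed

lemma eprod_shift_letter:
  assumes t: "central t" and "sorted_wrt (<) L" and "\<forall>b\<in>set L. b < m"
  shows "(1 + t * w m) * eprod w t L * w m
    = ((1 + t * w m) * w m + t * (\<Sum>a\<leftarrow>L. commutator (w a) (w m))) * eprod w t L"
  using assms(2,3)
proof (induction L)
  case Nil
  then show ?case by (simp add: algebra_simps)
next
  case (Cons a L)
  let ?u = "w m" and ?c = "commutator (w m) (w a)" and ?E = "eprod w t L" and ?f = "1 + t * w a"
    and ?C = "\<Sum>a\<leftarrow>L. commutator (w a) (w m)"
  from Cons.prems have am: "a < m" and L: "\<forall>b\<in>set L. a < b \<and> b < m"
    by auto
  have IH: "(1 + t * ?u) * ?E * ?u = ((1 + t * ?u) * ?u + t * ?C) * ?E"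
    using Cons by simp
  have f_u: "?f * ?u = ?u * ?f - t * ?c"
    using central_left_commute[OF t] by (simp add: algebra_simps commutator_def)
  have "(1 + t * ?u) * eprod w t (a # L) * ?u = (1 + t * ?u) * ?E * (?f * ?u)"
    by (simp add: mult.assoc)
  also have "\<dots> = (1 + t * ?u) * ?E * ?u * ?f - t * ((1 + t * ?u) * ?E * ?c)"
    by (simp add: f_u right_diff_distrib mult.assoc central_left_commute[OF t])
  also have "\<dots> = ((1 + t * ?u) * ?u + t * ?C) * ?E * ?f - t * (?c * ?E * ?f)"
    by (simp only: IH commutator_eprod_shift[OF t am L])
  also have "\<dots> = ((1 + t * ?u) * ?u + t * (\<Sum>b\<leftarrow>a # L. commutator (w b) (w m))) * eprod w t (a # L)"
    by (simp add: commutator_def algebra_simps)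
  finally show ?case .
qed

theorem eprod_commute_central:
  assumes x: "central x" and y: "central y" and "sorted_wrt (<) L"
  shows "eprod w x L * eprod w y L = eprod w y L * eprod w x L"
  using assms(3)
proof (induction L rule: rev_induct)
  case Nil
  then show ?case by simp
next
  case (snoc m L)
  from snoc.prems have L: "sorted_wrt (<) L" and Lm: "\<forall>b\<in>set L. b < m"
    by (auto simp: sorted_wrt_append)
  let ?u = "w m" and ?C = "\<Sum>a\<leftarrow>L. commutator (w a) (w m)"
  define S where "S p q = 1 + p * ?u + q * ?u + q * (p * (?u * ?u)) + q * (p * ?C)" for p q
  have shift: "(1 + p * ?u) * eprod w p L * (1 + q * ?u) = S p q * eprod w p L"
    if p: "central p" and q: "central q" for p q
  proof -
    have "(1 + p * ?u) * eprod w p L * (1 + q * ?u)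
        = (1 + p * ?u) * eprod w p L + q * ((1 + p * ?u) * eprod w p L * ?u)"
      by (simp add: distrib_left mult.assoc central_left_commute[OF q])
    also have "\<dots> = (1 + p * ?u) * eprod w p L + q * (((1 + p * ?u) * ?u + p * ?C) * eprod w p L)"
      by (simp only: eprod_shift_letter[OF p L Lm])
    also have "\<dots> = S p q * eprod w p L"
      by (simp add: S_def algebra_simps)
    finally show ?thesis .
  qed
  have S_sym: "S x y = S y x"
    using central_left_commute[OF x] by (simp add: S_def add_ac)
  have "eprod w x (L @ [m]) * eprod w y (L @ [m])
      = ((1 + x * ?u) * eprod w x L * (1 + y * ?u)) * eprod w y L"
    by (simp add: eprod_snoc mult.assoc)
  also have "\<dots> = S x y * (eprod w x L * eprod w y L)"
    unfolding shift[OF x y] by (simp add: mult.assoc)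
  also have "\<dots> = S y x * (eprod w y L * eprod w x L)"
    using snoc.IH[OF L] by (simp add: S_sym)
  also have "\<dots> = ((1 + y * ?u) * eprod w y L * (1 + x * ?u)) * eprod w x L"
    unfolding shift[OF y x] by (simp add: mult.assoc)
  also have "\<dots> = eprod w y (L @ [m]) * eprod w x (L @ [m])"
    by (simp add: eprod_snoc mult.assoc)
  finally show ?case .
qed

end

section \<open>Complete homogeneous products as inverses\<close>

definition geometric_fps :: "'a::ring_1 \<Rightarrow> 'a fps" where
  "geometric_fps c = Abs_fps (\<lambda>k. c ^ k)"

lemma geometric_fps_mult_const: "geometric_fps c * fps_const c = Abs_fps (\<lambda>k. c ^ Suc k)"
  by (rule fps_ext) (simp add: geometric_fps_def fps_const_mult_right power_commutes)

lemma const_mult_geometric_fps: "fps_const c * geometric_fps c = Abs_fps (\<lambda>k. c ^ Suc k)"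
  by (rule fps_ext) (simp add: geometric_fps_def)

lemma geometric_fps_inverse_left: "geometric_fps c * (1 - fps_X * fps_const c) = 1"
proof -
  have "geometric_fps c * (1 - fps_X * fps_const c) = geometric_fps c - fps_X * (geometric_fps c * fps_const c)"
    by (simp add: algebra_simps fps_mult_fps_X_commute)
  also have "\<dots> = 1"
  proof (rule fps_ext)
    show "fps_nth (geometric_fps c - fps_X * (geometric_fps c * fps_const c)) n = fps_nth 1 n" for n
      by (cases n) (simp_all add: geometric_fps_mult_const geometric_fps_def power_commutes)
  qed
  finally show ?thesis .
qed

lemma geometric_fps_inverse_right: "(1 - fps_X * fps_const c) * geometric_fps c = 1"
proof -
  have "(1 - fps_X * fps_const c) * geometric_fps c = geometric_fps c - fps_X * (fps_const c * geometric_fps c)"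
    by (simp add: algebra_simps)
  also have "\<dots> = 1"
  proof (rule fps_ext)
    show "fps_nth (geometric_fps c - fps_X * (fps_const c * geometric_fps c)) n = fps_nth 1 n" for n
      by (cases n) (simp_all add: const_mult_geometric_fps geometric_fps_def)
  qed
  finally show ?thesis .
qed

fun hprod :: "('n \<Rightarrow> 'a::ring_1) \<Rightarrow> 'n list \<Rightarrow> 'a fps" where
  "hprod w [] = 1"
| "hprod w (a # L) = geometric_fps (w a) * hprod w L"

lemma hprod_mult_eprod: "hprod w L * eprod (\<lambda>a. fps_const (w a)) (- fps_X) L = 1"
proof (induction L)
  case Nil
  then show ?case by simp
next
  case (Cons a L)
  have "hprod w (a # L) * eprod (\<lambda>a. fps_const (w a)) (- fps_X) (a # L)
      = geometric_fps (w a) * (hprod w L * eprod (\<lambda>a. fps_const (w a)) (- fps_X) L)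
        * (1 - fps_X * fps_const (w a))"
    by (simp add: mult.assoc)
  then show ?case
    by (simp add: Cons.IH geometric_fps_inverse_left)
qed

lemma eprod_mult_hprod: "eprod (\<lambda>a. fps_const (w a)) (- fps_X) L * hprod w L = 1"
proof (induction L)
  case Nil
  then show ?case by simp
next
  case (Cons a L)
  have "eprod (\<lambda>a. fps_const (w a)) (- fps_X) (a # L) * hprod w (a # L)
      = eprod (\<lambda>a. fps_const (w a)) (- fps_X) L
        * ((1 - fps_X * fps_const (w a)) * geometric_fps (w a)) * hprod w L"
    by (simp add: mult.assoc)
  then show ?case
    by (simp add: Cons.IH geometric_fps_inverse_right)
qed

definition sorted_words :: "'n::linorder list \<Rightarrow> nat \<Rightarrow> 'n list set" where
  "sorted_words L n = {xs. length xs = n \<and> sorted xs \<and> set xs \<subseteq> set L}"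

lemma finite_sorted_words: "finite (sorted_words L n)"
  by (rule finite_subset[OF _ finite_lists_length_eq[of "set L" n]]) (auto simp: sorted_words_def)

lemma replicate_append_inj:
  assumes "a \<notin> set ys" "a \<notin> set ys'" "replicate i a @ ys = replicate j a @ ys'"
  shows "i = j \<and> ys = ys'"
  using assms
proof (induction i arbitrary: j)
  case 0
  then show ?case by (cases j) auto
next
  case (Suc i)
  then show ?case by (cases j) auto
qed

lemma sorted_replicate_append_split:
  assumes "sorted xs" "\<forall>z\<in>set xs. a \<le> z"
  obtains i ys where "xs = replicate i a @ ys" "a \<notin> set ys"
  using assms
proof (induction xs arbitrary: thesis)
  case Nil
  then show ?case by simp
next
  case (Cons x xs)
  show ?case
  proof (cases "x = a")
    case True
    with Cons.prems obtain i ys where "xs = replicate i a @ ys" "a \<notin> set ys"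
      by (auto intro: Cons.IH)
    with True show ?thesis
      using Cons.prems(1)[of "Suc i" ys] by simp
  next
    case False
    with Cons.prems(2,3) have "a \<notin> set (x # xs)"
      by auto
    then show ?thesis
      using Cons.prems(1)[of 0 "x # xs"] by simp
  qed
qed

lemma bij_betw_sorted_words_Cons:
  assumes aL: "\<forall>b\<in>set L. a < b"
  shows "bij_betw (\<lambda>(i, ys). replicate i a @ ys)
           (SIGMA i:{0..n}. sorted_words L (n - i)) (sorted_words (a # L) n)"
proof (rule bij_betw_imageI)
  have a_notin: "a \<notin> set ys" if "ys \<in> sorted_words L k" for ys k
    using that aL by (auto simp: sorted_words_def)
  show "inj_on (\<lambda>(i, ys). replicate i a @ ys) (SIGMA i:{0..n}. sorted_words L (n - i))"
    by (rule inj_onI) (auto dest: a_notin replicate_append_inj)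
  show "(\<lambda>(i, ys). replicate i a @ ys) ` (SIGMA i:{0..n}. sorted_words L (n - i)) = sorted_words (a # L) n"
  proof (intro equalityI subsetI)
    fix xs
    assume "xs \<in> (\<lambda>(i, ys). replicate i a @ ys) ` (SIGMA i:{0..n}. sorted_words L (n - i))"
    then obtain i ys where "i \<le> n" "ys \<in> sorted_words L (n - i)" "xs = replicate i a @ ys"
      by auto
    with aL show "xs \<in> sorted_words (a # L) n"
      by (auto simp: sorted_words_def sorted_append intro: less_imp_le)
  next
    fix xs
    assume xs: "xs \<in> sorted_words (a # L) n"
    then have "sorted xs" "\<forall>z\<in>set xs. a \<le> z"
      using aL by (auto simp: sorted_words_def intro: less_imp_le)
    then obtain i ys where split: "xs = replicate i a @ ys" "a \<notin> set ys"
      by (rule sorted_replicate_append_split)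
    with xs have "(i, ys) \<in> (SIGMA i:{0..n}. sorted_words L (n - i))"
      by (auto simp: sorted_words_def sorted_append)
    with split show "xs \<in> (\<lambda>(i, ys). replicate i a @ ys) ` (SIGMA i:{0..n}. sorted_words L (n - i))"
      by force
  qed
qed

lemma hprod_nth:
  fixes w :: "'n::linorder \<Rightarrow> 'a::ring_1"
  assumes "sorted_wrt (<) L"
  shows "fps_nth (hprod w L) n = (\<Sum>xs\<in>sorted_words L n. prod_list (map w xs))"
  using assms
proof (induction L arbitrary: n)
  case Nil
  have "sorted_words ([] :: 'n list) 0 = {[]}" "sorted_words ([] :: 'n list) (Suc k) = {}" for k
    by (auto simp: sorted_words_def)
  then show ?case by (cases n) simp_all
next
  case (Cons a L)
  then have L: "sorted_wrt (<) L" and aL: "\<forall>b\<in>set L. a < b"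
    by auto
  have "fps_nth (hprod w (a # L)) n = (\<Sum>i=0..n. w a ^ i * fps_nth (hprod w L) (n - i))"
    by (simp add: fps_mult_nth geometric_fps_def)
  also have "\<dots> = (\<Sum>i=0..n. \<Sum>ys\<in>sorted_words L (n - i). w a ^ i * prod_list (map w ys))"
    by (simp add: Cons.IH[OF L] sum_distrib_left)
  also have "\<dots> = (\<Sum>(i, ys)\<in>(SIGMA i:{0..n}. sorted_words L (n - i)). prod_list (map w (replicate i a @ ys)))"
    by (simp add: sum.Sigma finite_sorted_words prod_list_replicate)
  also have "\<dots> = (\<Sum>xs\<in>sorted_words (a # L) n. prod_list (map w xs))"
    using sum.reindex_bij_betw[OF bij_betw_sorted_words_Cons[OF aL], of "\<lambda>xs. prod_list (map w xs)" n]
    by (simp add: case_prod_unfold)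
  finally show ?case .
qed

lemma hprod_const_nth:
  fixes w :: "'n::linorder \<Rightarrow> 'a::ring_1"
  assumes "sorted_wrt (<) L"
  shows "fps_nth (hprod (\<lambda>a. fps_const (w a)) L) n = fps_const (fps_nth (hprod w L) n)"
proof -
  have "prod_list (map (\<lambda>a. fps_const (w a)) xs) = fps_const (prod_list (map w xs))" for xs
    by (induction xs) simp_all
  then show ?thesis
    using sum_comp_morphism[of fps_const "\<lambda>xs. prod_list (map w xs)" "sorted_words L n"]
    by (simp add: hprod_nth[OF assms] o_def)
qed

section \<open>Commuting complete homogeneous elements\<close>

lemma central_uminus_fps_X: "central (- fps_X :: 'a::ring_1 fps)"
  unfolding central_def by (simp add: fps_mult_fps_X_commute)

lemma central_fps_const:
  fixes c :: "'a::ring_1"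
  assumes "central c"
  shows "central (fps_const c)"
  unfolding central_def
proof
  fix z
  show "fps_const c * z = z * fps_const c"
    using assms by (simp add: central_def fps_const_mult_left fps_const_mult_right)
qed

lemma commute_if_inverses_commute:
  fixes p p' q q' :: "'a::monoid_mult"
  assumes "p * p' = 1" "p' * p = 1" "q * q' = 1" "q' * q = 1" and "p' * q' = q' * p'"
  shows "p * q = q * p"
proof -
  have "(q' * p') * (p * q) = q' * ((p' * p) * q)"
    by (simp only: mult.assoc)
  then have left_inverse: "(q' * p') * (p * q) = 1"
    using assms(2,4) by simp
  have "(q * p) * (p' * q') = q * ((p * p') * q')"
    by (simp only: mult.assoc)
  then have right_inverse: "(q * p) * (p' * q') = 1"
    using assms(1,3) by simp
  have "q * p = (q * p) * ((p' * q') * (p * q))"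
    by (simp add: assms(5) left_inverse)
  also have "\<dots> = ((q * p) * (p' * q')) * (p * q)"
    by (simp only: mult.assoc)
  also have "\<dots> = p * q"
    by (simp add: right_inverse)
  finally show ?thesis by simp
qed

lemma fps_nth_nth_outer_inner_commutator:
  fixes f :: "nat \<Rightarrow> 'a::ring_1"
  shows "fps_nth (fps_nth (Abs_fps (\<lambda>l. fps_const (f l)) * fps_const (Abs_fps f)
      - fps_const (Abs_fps f) * Abs_fps (\<lambda>l. fps_const (f l))) a) b = f a * f b - f b * f a"
  by (simp add: fps_const_mult_right)

lemma (in C_relations) hprod_nth_commute:
  assumes L: "sorted_wrt (<) L"
  shows "fps_nth (hprod w L) k * fps_nth (hprod w L) l = fps_nth (hprod w L) l * fps_nth (hprod w L) k"
proof -
  define h where "h = fps_nth (hprod w L)"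
  define W :: "'n \<Rightarrow> 'a fps fps" where "W = (\<lambda>a. fps_const (fps_const (w a)))"
  define Hx where "Hx = Abs_fps (\<lambda>l. fps_const (h l))"
  define Hy where "Hy = fps_const (Abs_fps h)"
  have W: "C_relations W"
    unfolding W_def by (rule C_relations_hom[OF C_relations_axioms]) simp_all
  have Hx: "Hx = hprod (\<lambda>a. fps_const (w a)) L"
    by (rule fps_ext) (simp add: Hx_def h_def hprod_const_nth[OF L])
  have Ey: "eprod W (fps_const (- fps_X)) L = fps_const (eprod (\<lambda>a. fps_const (w a)) (- fps_X) L)"
    by (simp add: W_def eprod_hom[of fps_const])
  have "eprod W (- fps_X) L * eprod W (fps_const (- fps_X)) L
      = eprod W (fps_const (- fps_X)) L * eprod W (- fps_X) L"
    using C_relations.eprod_commute_central[OF W central_uminus_fps_X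
        central_fps_const[OF central_uminus_fps_X] L] .
  then have "Hx * Hy = Hy * Hx"
  proof (rule commute_if_inverses_commute[rotated 4])
    show "Hx * eprod W (- fps_X) L = 1" "eprod W (- fps_X) L * Hx = 1"
      unfolding Hx W_def by (rule hprod_mult_eprod, rule eprod_mult_hprod)
    show "Hy * eprod W (fps_const (- fps_X)) L = 1" "eprod W (fps_const (- fps_X)) L * Hy = 1"
      by (simp_all add: Ey Hy_def h_def fps_nth_inverse hprod_mult_eprod eprod_mult_hprod)
  qed
  then have "h k * h l - h l * h k = 0"
    using fps_nth_nth_outer_inner_commutator[of h k l] by (simp add: Hx_def Hy_def)
  then show ?thesis
    by (simp add: h_def)
qed

section \<open>The quotient ring \<open>U/I_C\<close>\<close>

lemma two_sided_ideal_I_C: "two_sided_ideal (I_C :: ('n::linorder) freering set)"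
  unfolding I_C_def by (rule two_sided_ideal_Inter) blast

lemma gensC_subset_I_C: "gensC \<subseteq> (I_C :: ('n::linorder) freering set)"
  unfolding I_C_def by auto

lemma lookup_mult_zero:
  fixes f g :: "'k::monoid_add \<Rightarrow>\<^sub>0 'a::semiring_0"
  assumes zero_sum_free: "\<And>l q :: 'k. l + q = 0 \<longleftrightarrow> l = 0 \<and> q = 0"
  shows "Poly_Mapping.lookup (f * g) 0 = Poly_Mapping.lookup f 0 * Poly_Mapping.lookup g 0"
proof -
  have "Sum_any (\<lambda>q. Poly_Mapping.lookup g q when 0 = l + q) = (Poly_Mapping.lookup g 0 when l = 0)" for l
  proof -
    have "Sum_any (\<lambda>q. Poly_Mapping.lookup g q when 0 = l + q)
        = Sum_any (\<lambda>q. (Poly_Mapping.lookup g q when l = 0) when q = 0)"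
      by (rule arg_cong[where f = Sum_any]) (auto simp: zero_sum_free when_def)
    then show ?thesis
      by simp
  qed
  then have "Sum_any (\<lambda>l. Poly_Mapping.lookup f l * Sum_any (\<lambda>q. Poly_Mapping.lookup g q when 0 = l + q))
      = Sum_any (\<lambda>l. Poly_Mapping.lookup f l * Poly_Mapping.lookup g 0 when l = 0)"
    by (simp add: mult_when)
  then show ?thesis
    by (simp add: lookup_mult)
qed

lemma fword_add_eq_0_iff: "l + q = (0 :: 'n fword) \<longleftrightarrow> l = 0 \<and> q = 0"
  by (cases l; cases q) (auto simp: zero_fword_def)

lemma one_notin_I_C: "(1 :: ('n::linorder) freering) \<notin> I_C"
proof
  assume one: "(1 :: 'n freering) \<in> I_C"
  let ?K = "{p :: 'n freering. Poly_Mapping.lookup p 0 = 0}"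
  have const_mult: "Poly_Mapping.lookup (p * q) 0 = Poly_Mapping.lookup p 0 * Poly_Mapping.lookup q 0" for p q :: "'n freering"
    by (rule lookup_mult_zero) (rule fword_add_eq_0_iff)
  have const_u: "Poly_Mapping.lookup (u i :: 'n freering) 0 = 0" for i
    by (simp add: u_def lookup_single zero_fword_def)
  have "two_sided_ideal ?K"
    unfolding two_sided_ideal_def by (simp add: lookup_add const_mult)
  moreover have "gensC \<subseteq> ?K"
    using const_u
    unfolding gensC_def by (auto simp: lookup_add lookup_minus const_mult)
  ultimately have "I_C \<subseteq> ?K"
    unfolding I_C_def by blast
  with one show False
    by (auto simp: lookup_one)
qed

quotient_type (overloaded) 'n freering_mod_C = "('n::linorder) freering" / "\<lambda>a b. a - b \<in> I_C"
  by (rule equivp_two_sided_ideal_cong[OF two_sided_ideal_I_C])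

instantiation freering_mod_C :: (linorder) ring_1
begin

lift_definition zero_freering_mod_C :: "'a freering_mod_C" is 0 .

lift_definition one_freering_mod_C :: "'a freering_mod_C" is 1 .

lift_definition plus_freering_mod_C :: "'a freering_mod_C \<Rightarrow> 'a freering_mod_C \<Rightarrow> 'a freering_mod_C"
  is "(+)"
  by (rule two_sided_ideal_cong_add[OF two_sided_ideal_I_C])

lift_definition uminus_freering_mod_C :: "'a freering_mod_C \<Rightarrow> 'a freering_mod_C" is uminus
  by (rule two_sided_ideal_cong_uminus[OF two_sided_ideal_I_C])

lift_definition minus_freering_mod_C :: "'a freering_mod_C \<Rightarrow> 'a freering_mod_C \<Rightarrow> 'a freering_mod_C"
  is "(-)"
  by (rule two_sided_ideal_cong_diff[OF two_sided_ideal_I_C])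

lift_definition times_freering_mod_C :: "'a freering_mod_C \<Rightarrow> 'a freering_mod_C \<Rightarrow> 'a freering_mod_C"
  is "(*)"
  by (rule two_sided_ideal_cong_mult[OF two_sided_ideal_I_C])

instance
proof
  fix a b c :: "'a freering_mod_C"
  have zero: "0 \<in> (I_C :: 'a freering set)"
    by (rule two_sided_ideal_zero[OF two_sided_ideal_I_C])
  show "a * b * c = a * (b * c)" by transfer (simp add: zero mult.assoc)
  show "1 * a = a" by transfer (simp add: zero)
  show "a * 1 = a" by transfer (simp add: zero)
  show "(a + b) * c = a * c + b * c" by transfer (simp add: zero distrib_right)
  show "a * (b + c) = a * b + a * c" by transfer (simp add: zero distrib_left)
  show "a + b + c = a + (b + c)" by transfer (simp add: zero add.assoc)
  show "a + b = b + a" by transfer (simp add: zero add.commute)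
  show "0 + a = a" by transfer (simp add: zero)
  show "- a + a = 0" by transfer (simp add: zero)
  show "a - b = a + - b" by transfer (simp add: zero)
  show "(0 :: 'a freering_mod_C) \<noteq> 1"
    by transfer (use one_notin_I_C two_sided_ideal_uminus[OF two_sided_ideal_I_C] in force)
qed

end

abbreviation quot_C :: "('n::linorder) freering \<Rightarrow> 'n freering_mod_C" where
  "quot_C \<equiv> abs_freering_mod_C"

lemma quot_C_add: "quot_C (a + b) = quot_C a + quot_C b"
  by (simp add: plus_freering_mod_C.abs_eq)

lemma quot_C_mult: "quot_C (a * b) = quot_C a * quot_C b"
  by (simp add: times_freering_mod_C.abs_eq)

lemma quot_C_diff: "quot_C (a - b) = quot_C a - quot_C b"
  by (simp add: minus_freering_mod_C.abs_eq)

lemma quot_C_eq_0_iff: "quot_C a = 0 \<longleftrightarrow> a \<in> I_C"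
  by (simp add: zero_freering_mod_C.abs_eq freering_mod_C.abs_eq_iff)

lemma quot_C_sum: "quot_C (sum f A) = (\<Sum>x\<in>A. quot_C (f x))"
  using sum_comp_morphism[of quot_C f A] by (simp add: zero_freering_mod_C.abs_eq quot_C_add o_def)

lemma quot_C_prod_list: "quot_C (prod_list xs) = prod_list (map quot_C xs)"
  by (induction xs) (simp_all add: one_freering_mod_C.abs_eq quot_C_mult)

lemma quot_C_gensC: "g \<in> gensC \<Longrightarrow> quot_C g = 0"
  using gensC_subset_I_C quot_C_eq_0_iff by blast

lemma C_relations_quot_C: "C_relations (\<lambda>i. quot_C (u i) :: ('n::linorder) freering_mod_C)"
proof -
  let ?w = "\<lambda>i. quot_C (u i) :: 'n freering_mod_C"
  note hom = quot_C_add quot_C_diff quot_C_mult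
  show ?thesis
  proof
    fix a b :: 'n
    assume "a < b"
    then have "quot_C (u b * u b * u a + u a * u b * u a - u b * u a * u b - u b * u a * u a) = 0"
      by (intro quot_C_gensC) (auto simp: gensC_def)
    then have "?w b * commutator (?w b) (?w a) - commutator (?w b) (?w a) * ?w a = 0"
      by (simp add: hom commutator_def algebra_simps)
    then show "?w b * commutator (?w b) (?w a) = commutator (?w b) (?w a) * ?w a"
      by simp
  next
    fix a b c :: 'n
    assume "a < b" "b < c"
    then have "quot_C (u b * u c * u a + u a * u c * u b - u b * u a * u c - u c * u a * u b) = 0"
      by (intro quot_C_gensC) (auto simp: gensC_def)
    then have "?w b * commutator (?w c) (?w a) - commutator (?w c) (?w a) * ?w b = 0"
      by (simp add: hom commutator_def algebra_simps)
    then show "?w b * commutator (?w c) (?w a) = commutator (?w c) (?w a) * ?w b"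
      by simp
  next
    fix a b c :: 'n
    assume "a < b" "b < c"
    then have "quot_C (u c * u b * u c * u a + u b * u c * u a * u c
        - u c * u b * u a * u c - u b * u c * u c * u a) = 0"
      by (intro quot_C_gensC) (auto simp: gensC_def)
    then show "commutator (?w c) (?w b) * commutator (?w c) (?w a) = 0"
      by (simp add: hom commutator_def algebra_simps)
  qed
qed

lemma quot_C_hsym:
  "quot_C (hsym k :: ('n::{finite,linorder}) freering)
    = fps_nth (hprod (\<lambda>i. quot_C (u i)) (sorted_list_of_set (UNIV :: 'n set))) k"
proof -
  have "sorted_words (sorted_list_of_set (UNIV :: 'n set)) k = {xs. length xs = k \<and> sorted xs}"
    by (auto simp: sorted_words_def)
  then show ?thesis
    by (simp add: hprod_nth strict_sorted_list_of_set hsym_def quot_C_sum quot_C_prod_list o_def)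
qed

lemma hsym_commutator_in_I_C:
  "hsym k * hsym l - hsym l * hsym k \<in> (I_C :: ('n::{finite,linorder}) freering set)"
proof -
  interpret C_relations "\<lambda>i. quot_C (u i) :: 'n freering_mod_C"
    by (rule C_relations_quot_C)
  have "quot_C (hsym k :: 'n freering) * quot_C (hsym l) = quot_C (hsym l) * quot_C (hsym k)"
    unfolding quot_C_hsym by (rule hprod_nth_commute) (simp add: strict_sorted_list_of_set)
  then show ?thesis
    by (simp add: quot_C_diff quot_C_mult flip: quot_C_eq_0_iff)
qed

theorem corollary2p4:
  fixes I :: "('n::{finite,linorder}) freering set"
  assumes "two_sided_ideal I" and "I_C \<subseteq> I"
  shows "(\<forall>k l. 1 \<le> k \<longrightarrow> 1 \<le> l \<longrightarrow> hsym k * hsym l - hsym l * hsym k \<in> I)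
       \<and> (\<forall>a b. fps_nth (fps_nth ((Hx :: 'n freering fps fps) * Hy - Hy * Hx) a) b \<in> I)"
  using hsym_commutator_in_I_C assms(2)
  by (auto simp: Hx_def Hy_def fps_nth_nth_outer_inner_commutator)

end
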